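(* Let $(\mathcal P,\diamond,\alpha)$ be an admissible Hom-Poisson algebra, $(V,\rho,\mu,\beta)$ a representation of $\mathcal P$ with $\beta$ invertible, and $T:V\to\mathcal P$ a Hom-$\mathcal O$-operator associated to $(V,\rho,\mu,\beta)$. Define operations $\prec_T,\succ_T$ on $V$ by $$u\prec_T v=\mu\big(T(\beta^{-1}(v))\big)u,\qquad u\succ_T v=\rho\big(T(\beta^{-1}(u))\big)v,\qquad u,v\in V.$$ Then $(V,\prec_T,\succ_T,\beta)$ is an admissible Hom-pre-Poisson algebra.
   Context: All vector spaces are finite-dimensional over a field $\mathbb F$ in which $3$ is invertible. An admissible Hom-Poisson algebra is a triple $(A,\diamond,\alpha)$ consisting of a vector space $A$, a bilinear operation $\diamond:A\otimes A\to A$ and a linear map $\alpha:A\to A$ with $\alpha(x\diamond y)=\alpha(x)\diamond\alpha(y)$ (multiplicativity, a standing assumption) such that for all $x,y,z\in A$ $$(x\diamond y)\diamond \alpha(z)=\alpha(x)\diamond(y\diamond z)-\tfrac13\big(-\alpha(x)\diamond (z\diamond y)+\alpha(z)\diamond( x\diamond y)+\alpha(y)\diamond (x\diamond z)- \alpha(y)\diamond(z\diamond x)\big).$$ A representation of $(A,\diamond,\alpha)$ is a quadruple $(V,\rho,\mu,\beta)$ with $V$ a vector space, $\beta\in\mathrm{End}(V)$ and $\rho,\mu:A\to\mathrm{End}(V)$ linear maps such that for all $x,y\in A$ (juxtaposition is composition): $$\rho(\alpha(x))\beta=\beta\rho(x),\qquad \mu(\alpha(x))\beta=\beta\mu(x),$$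 $$\rho(x\diamond y)\beta=\rho(\alpha(x))\rho(y)-\tfrac13\big(-\rho(\alpha(x))\mu(y)+\mu(x\diamond y)\beta+\rho(\alpha(y))\rho(x)-\rho(\alpha(y))\mu(x)\big),$$ $$\mu(\alpha(y))\rho(x)=\rho(\alpha(x))\mu(y)-\tfrac13\big(-\rho(\alpha(x))\rho(y)+\rho(\alpha(y))\rho(x)+\mu(x\diamond y)\beta-\mu(y\diamond x)\beta\big),$$ $$\mu(\alpha(y))\mu(x)=\mu(x\diamond y)\beta-\tfrac13\big(-\mu(y\diamond x)\beta+\rho(\alpha(y))\mu(x)+\rho(\alpha(x))\mu(y)-\rho(\alpha(x))\rho(y)\big).$$ A (Hom-)$\mathcal O$-operator of $(A,\diamond,\alpha)$ associated to $(V,\rho,\mu,\beta)$ ($\beta$ invertible) is a linear map $T:V\to A$ with $T\circ\beta=\alpha\circ T$ and $$T(u)\diamond T(v)=T\big(\rho(T(\beta^{-1}(u)))v+\mu(T(\beta^{-1}(v)))u\big)\quad\text{for all }u,v\in V.$$ An admissible Hom-pre-Poisson algebra is a vector space $\mathcal P$ with two bilinear operations $\succ,\prec$ and a linear map $\alpha:\mathcal P\to\mathcal P$ which is multiplicative for both operations ($\alpha(x\succ y)=\alpha(x)\succ\alpha(y)$, $\alpha(x\prec y)=\alpha(x)\prec\alpha(y)$; standing assumption), such that for all $x,y,z\in\mathcal P$: $$-(x\succ y)\succ\alpha(z)-(x\prec y)\succ\alpha(z)+\alpha(x)\succ(y\succ z)+\tfrac13\big(\alpha(x)\succ(z\prec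 y)-\alpha(z)\prec(x\succ y)-\alpha(z)\prec(x\prec y)-\alpha(y)\succ(x\succ z)+\alpha(y)\succ(z\prec x)\big)=0,$$ $$-\alpha(x)\succ(z\prec y)+(x\succ z)\prec\alpha(y)+\tfrac13\big(-\alpha(x)\succ(y\succ z)+\alpha(y)\succ(x\succ z)+\alpha(z)\prec(x\prec y)+\alpha(z)\prec(x\succ y)-\alpha(z)\prec(y\succ x)-\alpha(z)\prec(y\prec x)\big)=0,$$ $$-\alpha(z)\prec(x\succ y)-\alpha(z)\prec(x\prec y)+(z\prec x)\prec\alpha(y)+\tfrac13\big(-\alpha(z)\prec(y\succ x)-\alpha(z)\prec(y\prec x)+\alpha(y)\succ(z\prec x)+\alpha(x)\succ(z\prec y)-\alpha(x)\succ(y\succ z)\big)=0.$$ *)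

theory Defs
  imports "HOL.Vector_Spaces"
begin

text \<open>
  For \<open>f :: 'a \<Rightarrow> 'b \<Rightarrow> 'c\<close> this is bilinearity of \<open>f\<close>. When the last two spaces coincide, it says
  equivalently that \<open>f\<close> is a linear map from the first space into the endomorphisms of the second:
  every \<open>f x\<close> is an endomorphism, and \<open>f\<close> is linear for the pointwise operations.
\<close>
definition bilinear_map ::
  "('f::field \<Rightarrow> 'a::ab_group_add \<Rightarrow> 'a) \<Rightarrow> ('f \<Rightarrow> 'b::ab_group_add \<Rightarrow> 'b) \<Rightarrow>
   ('f \<Rightarrow> 'c::ab_group_add \<Rightarrow> 'c) \<Rightarrow> ('a \<Rightarrow> 'b \<Rightarrow> 'c) \<Rightarrow> bool" where
  "bilinear_map s1 s2 s3 f \<longleftrightarrow>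
     (\<forall>x. Vector_Spaces.linear s2 s3 (f x)) \<and> (\<forall>y. Vector_Spaces.linear s1 s3 (\<lambda>x. f x y))"

text \<open>
  The second parameter of the locales below is a finite basis, as required by
  \<^locale>\<open>finite_dimensional_vector_space\<close>; it only witnesses that the dimension is finite.
\<close>

locale admissible_Hom_Poisson_algebra =
  finite_dimensional_vector_space scale Basis
  for scale :: "'f::field \<Rightarrow> 'a::ab_group_add \<Rightarrow> 'a" (infixr \<open>*s\<close> 75)
    and Basis :: "'a set" +
  fixes mult :: "'a \<Rightarrow> 'a \<Rightarrow> 'a" (infixl \<open>\<diamondop>\<close> 70)
    and \<alpha> :: "'a \<Rightarrow> 'a"
  assumes three_invertible: "(3::'f) \<noteq> 0"
    and bilinear_mult: "bilinear_map scale scale scale mult"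
    and linear_twist: "Vector_Spaces.linear scale scale \<alpha>"
    and multiplicative: "\<alpha> (x \<diamondop> y) = \<alpha> x \<diamondop> \<alpha> y"
    and admissible:
      "(x \<diamondop> y) \<diamondop> \<alpha> z =
         \<alpha> x \<diamondop> (y \<diamondop> z)
         - (1/3) *s (- (\<alpha> x \<diamondop> (z \<diamondop> y)) + \<alpha> z \<diamondop> (x \<diamondop> y)
                     + \<alpha> y \<diamondop> (x \<diamondop> z) - \<alpha> y \<diamondop> (z \<diamondop> x))"

text \<open>
  The identities between endomorphisms of the representation space are stated pointwise, at \<open>v\<close>.
\<close>
locale admissible_Hom_Poisson_representation =
  A: admissible_Hom_Poisson_algebra scaleA BasisA mult \<alpha> +
  V: finite_dimensional_vector_space scaleV BasisV
  for scaleA :: "'f::field \<Rightarrow> 'a::ab_group_add \<Rightarrow> 'a"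
    and BasisA :: "'a set"
    and mult :: "'a \<Rightarrow> 'a \<Rightarrow> 'a" (infixl \<open>\<diamondop>\<close> 70)
    and \<alpha> :: "'a \<Rightarrow> 'a"
    and scaleV :: "'f \<Rightarrow> 'v::ab_group_add \<Rightarrow> 'v" (infixr \<open>*v\<close> 75)
    and BasisV :: "'v set" +
  fixes \<rho> \<mu> :: "'a \<Rightarrow> 'v \<Rightarrow> 'v"
    and \<beta> :: "'v \<Rightarrow> 'v"
  assumes linear_beta: "Vector_Spaces.linear scaleV scaleV \<beta>"
    and linear_rho: "bilinear_map scaleA scaleV scaleV \<rho>"
    and linear_mu: "bilinear_map scaleA scaleV scaleV \<mu>"
    and rho_beta: "\<rho> (\<alpha> x) (\<beta> v) = \<beta> (\<rho> x v)"
    and mu_beta: "\<mu> (\<alpha> x) (\<beta> v) = \<beta> (\<mu> x v)"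
    and rho_mult:
      "\<rho> (x \<diamondop> y) (\<beta> v) =
         \<rho> (\<alpha> x) (\<rho> y v)
         - (1/3) *v (- \<rho> (\<alpha> x) (\<mu> y v) + \<mu> (x \<diamondop> y) (\<beta> v)
                     + \<rho> (\<alpha> y) (\<rho> x v) - \<rho> (\<alpha> y) (\<mu> x v))"
    and mu_rho:
      "\<mu> (\<alpha> y) (\<rho> x v) =
         \<rho> (\<alpha> x) (\<mu> y v)
         - (1/3) *v (- \<rho> (\<alpha> x) (\<rho> y v) + \<rho> (\<alpha> y) (\<rho> x v)
                     + \<mu> (x \<diamondop> y) (\<beta> v) - \<mu> (y \<diamondop> x) (\<beta> v))"
    and mu_mu:
      "\<mu> (\<alpha> y) (\<mu> x v) =
         \<mu> (x \<diamondop> y) (\<beta> v)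
         - (1/3) *v (- \<mu> (y \<diamondop> x) (\<beta> v) + \<rho> (\<alpha> y) (\<mu> x v)
                     + \<rho> (\<alpha> x) (\<mu> y v) - \<rho> (\<alpha> x) (\<rho> y v))"

locale Hom_O_operator =
  admissible_Hom_Poisson_representation scaleA BasisA mult \<alpha> scaleV BasisV \<rho> \<mu> \<beta>
  for scaleA :: "'f::field \<Rightarrow> 'a::ab_group_add \<Rightarrow> 'a"
    and BasisA :: "'a set"
    and mult :: "'a \<Rightarrow> 'a \<Rightarrow> 'a" (infixl \<open>\<diamondop>\<close> 70)
    and \<alpha> :: "'a \<Rightarrow> 'a"
    and scaleV :: "'f \<Rightarrow> 'v::ab_group_add \<Rightarrow> 'v"
    and BasisV :: "'v set"
    and \<rho> \<mu> :: "'a \<Rightarrow> 'v \<Rightarrow> 'v"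
    and \<beta> :: "'v \<Rightarrow> 'v" +
  fixes T :: "'v \<Rightarrow> 'a"
  assumes beta_invertible: "bij \<beta>"
    and linear_T: "Vector_Spaces.linear scaleV scaleA T"
    and T_beta: "T \<circ> \<beta> = \<alpha> \<circ> T"
    and O_identity: "T u \<diamondop> T v = T (\<rho> (T (inv \<beta> u)) v + \<mu> (T (inv \<beta> v)) u)"

locale admissible_Hom_pre_Poisson_algebra =
  finite_dimensional_vector_space scale Basis
  for scale :: "'f::field \<Rightarrow> 'p::ab_group_add \<Rightarrow> 'p" (infixr \<open>*s\<close> 75)
    and Basis :: "'p set" +
  fixes prec :: "'p \<Rightarrow> 'p \<Rightarrow> 'p" (infixl \<open>\<prec>\<close> 70)
    and succ :: "'p \<Rightarrow> 'p \<Rightarrow> 'p" (infixl \<open>\<succ>\<close> 70)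
    and \<alpha> :: "'p \<Rightarrow> 'p"
  assumes three_invertible: "(3::'f) \<noteq> 0"
    and bilinear_prec: "bilinear_map scale scale scale prec"
    and bilinear_succ: "bilinear_map scale scale scale succ"
    and linear_twist: "Vector_Spaces.linear scale scale \<alpha>"
    and multiplicative_succ: "\<alpha> (x \<succ> y) = \<alpha> x \<succ> \<alpha> y"
    and multiplicative_prec: "\<alpha> (x \<prec> y) = \<alpha> x \<prec> \<alpha> y"
    and pre_Poisson_1:
      "- ((x \<succ> y) \<succ> \<alpha> z) - (x \<prec> y) \<succ> \<alpha> z + \<alpha> x \<succ> (y \<succ> z)
       + (1/3) *s (\<alpha> x \<succ> (z \<prec> y) - \<alpha> z \<prec> (x \<succ> y) - \<alpha> z \<prec> (x \<prec> y)
                   - \<alpha> y \<succ> (x \<succ> z) + \<alpha> y \<succ> (z \<prec> x)) = 0"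
    and pre_Poisson_2:
      "- (\<alpha> x \<succ> (z \<prec> y)) + (x \<succ> z) \<prec> \<alpha> y
       + (1/3) *s (- (\<alpha> x \<succ> (y \<succ> z)) + \<alpha> y \<succ> (x \<succ> z)
                   + \<alpha> z \<prec> (x \<prec> y) + \<alpha> z \<prec> (x \<succ> y)
                   - \<alpha> z \<prec> (y \<succ> x) - \<alpha> z \<prec> (y \<prec> x)) = 0"
    and pre_Poisson_3:
      "- (\<alpha> z \<prec> (x \<succ> y)) - \<alpha> z \<prec> (x \<prec> y) + (z \<prec> x) \<prec> \<alpha> y
       + (1/3) *s (- (\<alpha> z \<prec> (y \<succ> x)) - \<alpha> z \<prec> (y \<prec> x)
                   + \<alpha> y \<succ> (z \<prec> x) + \<alpha> x \<succ> (z \<prec> y) - \<alpha> x \<succ> (y \<succ> z)) = 0"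

end

theory Submission
  imports Defs
begin

text \<open>
  Put \<open>S = T \<circ> \<beta>\<inverse>\<close>, so that \<open>u \<succ> v = \<rho> (S u) v\<close> and \<open>u \<prec> v = \<mu> (S v) u\<close>. Everything rests on two
  properties of \<open>S\<close>: it intertwines the twists, \<open>S (\<beta> u) = \<alpha> (S u)\<close>, and it is a homomorphism
  from the sum of the two products to the Poisson product,
  \<open>S (u \<succ> v + u \<prec> v) = S u \<diamondop> S v\<close> (lemma \<open>shifted_operator_hom\<close>).
  Their effect is that in the pre-Poisson axioms at \<open>x, y, z\<close> the iterated products, those
  containing \<open>x \<succ> y\<close> or \<open>y \<succ> x\<close> being added to their companions with \<open>\<prec>\<close>, become operators on \<open>z\<close>
  built from \<open>a = S x\<close> and \<open>b = S y\<close> alone. For instance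
  \<open>(x \<succ> y) \<succ> \<beta> z + (x \<prec> y) \<succ> \<beta> z = \<rho> (a \<diamondop> b) (\<beta> z)\<close> and \<open>\<beta> x \<succ> (z \<prec> y) = \<rho> (\<alpha> a) (\<mu> b z)\<close>.
  The three pre-Poisson axioms then become, in order, the representation axioms
  \<open>rho_mult\<close>, \<open>mu_rho\<close> and \<open>mu_mu\<close> for \<open>a\<close>, \<open>b\<close>, applied to \<open>z\<close>. Multiplicativity of \<open>\<beta>\<close> is
  in the same way the equivariance of \<open>\<rho>\<close> and \<open>\<mu>\<close>.
\<close>

lemma linear_inv_of_bij:
  assumes "Vector_Spaces.linear s1 s2 f" and "bij f"
  shows "Vector_Spaces.linear s2 s1 (inv f)"
proof -
  interpret f: Vector_Spaces.linear s1 s2 f by (fact assms(1))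
  have f_inv: "f (inv f y) = y" for y
    using assms(2) by (simp add: bij_is_surj surj_f_inv_f)
  have inv_f: "inv f (f x) = x" for x
    using assms(2) by (simp add: bij_is_inj)
  show ?thesis
  proof unfold_locales
    fix x y
    have "inv f (f (inv f x + inv f y)) = inv f x + inv f y" by (rule inv_f)
    then show "inv f (x + y) = inv f x + inv f y" by (simp add: f.add f_inv)
  next
    fix c x
    have "inv f (f (s1 c (inv f x))) = s1 c (inv f x)" by (rule inv_f)
    then show "inv f (s2 c x) = s1 c (inv f x)" by (simp add: f.scale f_inv)
  qed
qed

context Hom_O_operator
begin

definition shifted_operator :: "'v \<Rightarrow> 'a" where
  "shifted_operator u = T (inv \<beta> u)"

lemma beta_inv_beta: "\<beta> (inv \<beta> u) = u"
  using beta_invertible by (simp add: bij_is_surj surj_f_inv_f)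

lemma inv_beta_beta: "inv \<beta> (\<beta> u) = u"
  using beta_invertible by (simp add: bij_is_inj)

lemma linear_shifted_operator: "Vector_Spaces.linear scaleV scaleA shifted_operator"
proof -
  have "Vector_Spaces.linear scaleV scaleA (T \<circ> inv \<beta>)"
    using linear_inv_of_bij[OF linear_beta beta_invertible] linear_T
    by (rule Vector_Spaces.linear_compose)
  then show ?thesis
    by (simp add: shifted_operator_def[abs_def] comp_def)
qed

lemma shifted_operator_beta: "shifted_operator (\<beta> u) = \<alpha> (shifted_operator u)"
proof -
  have "T (\<beta> (inv \<beta> u)) = \<alpha> (T (inv \<beta> u))"
    using T_beta by (metis comp_apply)
  then show ?thesis
    by (simp add: shifted_operator_def beta_inv_beta inv_beta_beta)
qed

text \<open>
  The identity of an \<open>\<O>\<close>-operator, read at \<open>\<beta>\<inverse> u\<close> and \<open>\<beta>\<inverse> v\<close>: equivariance of \<open>\<rho>\<close> and \<open>\<mu>\<close>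
  pulls the \<open>\<beta>\<inverse>\<close> on the arguments out in front of the sum, where \<open>T\<close> absorbs it.
\<close>
lemma shifted_operator_hom:
  "shifted_operator (\<rho> (shifted_operator u) v + \<mu> (shifted_operator v) u)
     = shifted_operator u \<diamondop> shifted_operator v"
proof -
  interpret b: Vector_Spaces.linear scaleV scaleV \<beta> by (rule linear_beta)
  let ?u = "inv \<beta> u" and ?v = "inv \<beta> v"
  let ?w = "\<rho> (shifted_operator ?u) ?v + \<mu> (shifted_operator ?v) ?u"
  have "\<beta> ?w = \<rho> (shifted_operator u) v + \<mu> (shifted_operator v) u"
    by (simp add: b.add beta_inv_beta
        flip: rho_beta mu_beta shifted_operator_beta)
  then have "shifted_operator (\<rho> (shifted_operator u) v + \<mu> (shifted_operator v) u) = T ?w"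
    by (metis inv_beta_beta shifted_operator_def)
  also have "\<dots> = T ?u \<diamondop> T ?v"
    by (simp add: O_identity shifted_operator_def)
  finally show ?thesis
    by (simp add: shifted_operator_def)
qed

theorem induced_pre_Poisson_algebra:
  "admissible_Hom_pre_Poisson_algebra scaleV BasisV
     (\<lambda>u v. \<mu> (shifted_operator v) u) (\<lambda>u v. \<rho> (shifted_operator u) v) \<beta>"
proof -
  let ?S = shifted_operator
  have lin_rho: "Vector_Spaces.linear scaleV scaleV (\<rho> a)"
      "Vector_Spaces.linear scaleA scaleV (\<lambda>x. \<rho> x v)"
    and lin_mu: "Vector_Spaces.linear scaleV scaleV (\<mu> a)"
      "Vector_Spaces.linear scaleA scaleV (\<lambda>x. \<mu> x v)" for a v
    using linear_rho linear_mu by (simp_all add: bilinear_map_def)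
  have lin_comp: "Vector_Spaces.linear scaleV scaleV (\<lambda>x. \<rho> (?S x) v)"
      "Vector_Spaces.linear scaleV scaleV (\<lambda>x. \<mu> (?S x) v)" for v
    using Vector_Spaces.linear_compose[OF linear_shifted_operator lin_rho(2)]
      Vector_Spaces.linear_compose[OF linear_shifted_operator lin_mu(2)]
    by (simp_all add: comp_def)
  interpret S: Vector_Spaces.linear scaleV scaleA ?S by (rule linear_shifted_operator)
  have rho_sum: "\<rho> (?S (\<rho> (?S x) y)) v + \<rho> (?S (\<mu> (?S y) x)) v = \<rho> (?S x \<diamondop> ?S y) v" for x y v
  proof -
    interpret r: Vector_Spaces.linear scaleA scaleV "\<lambda>x. \<rho> x v" by (rule lin_rho(2))
    show ?thesis by (simp flip: r.add S.add add: shifted_operator_hom)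
  qed
  have mu_sum: "\<mu> (?S (\<rho> (?S x) y)) v + \<mu> (?S (\<mu> (?S y) x)) v = \<mu> (?S x \<diamondop> ?S y) v" for x y v
  proof -
    interpret m: Vector_Spaces.linear scaleA scaleV "\<lambda>x. \<mu> x v" by (rule lin_mu(2))
    show ?thesis by (simp flip: m.add S.add add: shifted_operator_hom)
  qed
  show ?thesis
  proof (intro admissible_Hom_pre_Poisson_algebra.intro admissible_Hom_pre_Poisson_algebra_axioms.intro)
    show "finite_dimensional_vector_space scaleV BasisV"
      by (rule V.finite_dimensional_vector_space_axioms)
    show "(3::'f) \<noteq> 0" by (rule A.three_invertible)
    show "bilinear_map scaleV scaleV scaleV (\<lambda>u v. \<mu> (?S v) u)"
      "bilinear_map scaleV scaleV scaleV (\<lambda>u v. \<rho> (?S u) v)"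
      by (simp_all add: bilinear_map_def lin_rho(1) lin_mu(1) lin_comp)
    show "Vector_Spaces.linear scaleV scaleV \<beta>" by (rule linear_beta)
  next
    fix x y
    show "\<beta> (\<rho> (?S x) y) = \<rho> (?S (\<beta> x)) (\<beta> y)"
      "\<beta> (\<mu> (?S y) x) = \<mu> (?S (\<beta> y)) (\<beta> x)"
      by (simp_all add: shifted_operator_beta rho_beta mu_beta)
  next
    fix x y z
    note sums = rho_sum[of x y "\<beta> z", symmetric]
      mu_sum[of x y "\<beta> z", symmetric] mu_sum[of y x "\<beta> z", symmetric]
    show "- \<rho> (?S (\<rho> (?S x) y)) (\<beta> z) - \<rho> (?S (\<mu> (?S y) x)) (\<beta> z) + \<rho> (?S (\<beta> x)) (\<rho> (?S y) z)
      + scaleV (1/3) (\<rho> (?S (\<beta> x)) (\<mu> (?S y) z) - \<mu> (?S (\<rho> (?S x) y)) (\<beta> z)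
          - \<mu> (?S (\<mu> (?S y) x)) (\<beta> z) - \<rho> (?S (\<beta> y)) (\<rho> (?S x) z) + \<rho> (?S (\<beta> y)) (\<mu> (?S x) z)) = 0"
      using rho_mult[where x = "?S x" and y = "?S y" and v = z]
      unfolding sums shifted_operator_beta by (simp add: algebra_simps)
    show "- \<rho> (?S (\<beta> x)) (\<mu> (?S y) z) + \<mu> (?S (\<beta> y)) (\<rho> (?S x) z)
      + scaleV (1/3) (- \<rho> (?S (\<beta> x)) (\<rho> (?S y) z) + \<rho> (?S (\<beta> y)) (\<rho> (?S x) z)
          + \<mu> (?S (\<mu> (?S y) x)) (\<beta> z) + \<mu> (?S (\<rho> (?S x) y)) (\<beta> z)
          - \<mu> (?S (\<rho> (?S y) x)) (\<beta> z) - \<mu> (?S (\<mu> (?S x) y)) (\<beta> z)) = 0"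
      using mu_rho[where x = "?S x" and y = "?S y" and v = z]
      unfolding sums shifted_operator_beta
      by (simp add: algebra_simps V.scale_right_distrib V.scale_right_diff_distrib)
    show "- \<mu> (?S (\<rho> (?S x) y)) (\<beta> z) - \<mu> (?S (\<mu> (?S y) x)) (\<beta> z) + \<mu> (?S (\<beta> y)) (\<mu> (?S x) z)
      + scaleV (1/3) (- \<mu> (?S (\<rho> (?S y) x)) (\<beta> z) - \<mu> (?S (\<mu> (?S x) y)) (\<beta> z)
          + \<rho> (?S (\<beta> y)) (\<mu> (?S x) z) + \<rho> (?S (\<beta> x)) (\<mu> (?S y) z)
          - \<rho> (?S (\<beta> x)) (\<rho> (?S y) z)) = 0"
      using mu_mu[where x = "?S x" and y = "?S y" and v = z]
      unfolding sums shifted_operator_beta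
      by (simp add: algebra_simps V.scale_right_distrib V.scale_right_diff_distrib)
  qed
qed

end

theorem lemma6p15:
  fixes scaleP :: "'f::field \<Rightarrow> 'a::ab_group_add \<Rightarrow> 'a"
    and BasisP :: "'a set"
    and mult :: "'a \<Rightarrow> 'a \<Rightarrow> 'a"
    and \<alpha> :: "'a \<Rightarrow> 'a"
    and scaleV :: "'f \<Rightarrow> 'v::ab_group_add \<Rightarrow> 'v"
    and BasisV :: "'v set"
    and \<rho> \<mu> :: "'a \<Rightarrow> 'v \<Rightarrow> 'v"
    and \<beta> :: "'v \<Rightarrow> 'v"
    and T :: "'v \<Rightarrow> 'a"
  assumes "admissible_Hom_Poisson_algebra scaleP BasisP mult \<alpha>"
    and "admissible_Hom_Poisson_representation scaleP BasisP mult \<alpha> scaleV BasisV \<rho> \<mu> \<beta>"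
    and "bij \<beta>"
    and "Hom_O_operator scaleP BasisP mult \<alpha> scaleV BasisV \<rho> \<mu> \<beta> T"
  shows "admissible_Hom_pre_Poisson_algebra scaleV BasisV
           (\<lambda>u v. \<mu> (T (inv \<beta> v)) u)
           (\<lambda>u v. \<rho> (T (inv \<beta> u)) v)
           \<beta>"
proof -
  interpret Hom_O_operator scaleP BasisP mult \<alpha> scaleV BasisV \<rho> \<mu> \<beta> T by (fact assms(4))
  show ?thesis
    using induced_pre_Poisson_algebra by (simp add: shifted_operator_def)
qed

end
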